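(* Let $X$ be a real Banach space and let $\kappa$ be an infinite cardinal. Then: (1) If $X$ is an $\mathrm{AUD}_{<\kappa}$ space, then $X$ is $\mathrm{ASQ}_{<\kappa}$ and it is $<\kappa$-octahedral. (2) If $X$ is a $\mathrm{UD}_{<\kappa}$ space, then $X$ is $\mathrm{SQ}_{<\kappa}$ and fails the $(-1)$-$\mathrm{BCP}_{<\kappa}$.
   Context: For a normed space $Z$, $\operatorname{dens}(Z)$ is the least cardinality of a subset of $Z$ whose linear span is dense in $Z$ (so it equals $\dim Z$ if $Z$ is finite dimensional); $S_Z$ is its unit sphere. Isometries are linear norm-preserving maps (not necessarily onto). $X$ is a $\mathrm{UD}_{<\kappa}$ space (resp. $\mathrm{AUD}_{<\kappa}$ space) if for any two normed spaces $Y\subseteq Z$ with $\operatorname{dens}(Z)<\kappa$ and any isometry $t:Y\to X$ there is a linear extension $T:Z\to X$ of $t$ which is an isometry (resp. for every $\varepsilon>0$ there is a linear extension $T:Z\to X$ of $t$ with $(1-\varepsilon)\|z\|\le\|T(z)\|\le(1+\varepsilon)\|z\|$ for all $z\in Z$). In the following, $Y$ ranges over all subspaces of $X$ with $\operatorname{dens}(Y)<\kappa$, and the inequalities are required for all $y\in Y$, $\lambda\in\mathbb R$: - $X$ is $\mathrm{ASQ}_{<\kappa}$ if for every $Y$ and $\varepsilon>0$ there is $x\in S_X$ with $\|y+\lambda x\|\le(1+\varepsilon)\max\{\|y\|,|\lambda|\}$. - $X$ is $\mathrm{SQ}_{<\kappa}$ if for every $Y$ there is $x\in S_X$ with $\|y+\lambda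 x\|\le\max\{\|y\|,|\lambda|\}$. - $X$ is $<\kappa$-octahedral if for every $Y$ and $\varepsilon>0$ there is $x\in S_X$ with $\|y+\lambda x\|\ge(1-\varepsilon)(\|y\|+|\lambda|)$. - $X$ fails the $(-1)$-$\mathrm{BCP}_{<\kappa}$ if for every $Y$ there is $x\in S_X$ with $\|y+\lambda x\|=\|y\|+|\lambda|$. *)

theory Defs
  imports "HOL-Analysis.Analysis" "HOL-Analysis.Finite_Function_Topology"
begin

unbundle cardinal_syntax

text \<open>
  A normed space is given as a linear subspace \<open>Z\<close> of a real vector space \<open>'v\<close> together with
  an arbitrary norm \<open>N\<close> on \<open>Z\<close>. The norm that \<open>'v\<close> may carry as a type plays no role,
  and the values of \<open>N\<close> outside \<open>Z\<close> are irrelevant.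
\<close>

definition normed_space_on :: "'v::real_vector set \<Rightarrow> ('v \<Rightarrow> real) \<Rightarrow> bool" where
  "normed_space_on Z N \<longleftrightarrow> subspace Z \<and>
     (\<forall>x\<in>Z. 0 \<le> N x) \<and> (\<forall>x\<in>Z. N x = 0 \<longleftrightarrow> x = 0) \<and>
     (\<forall>c. \<forall>x\<in>Z. N (c *\<^sub>R x) = \<bar>c\<bar> * N x) \<and>
     (\<forall>x\<in>Z. \<forall>y\<in>Z. N (x + y) \<le> N x + N y)"

definition spans_densely :: "('v::real_vector \<Rightarrow> real) \<Rightarrow> 'v set \<Rightarrow> 'v set \<Rightarrow> bool" where
  "spans_densely N Z D \<longleftrightarrow> D \<subseteq> Z \<and> (\<forall>z\<in>Z. \<forall>e>0. \<exists>u\<in>span D. N (z - u) < e)"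

definition dens :: "('v::real_vector \<Rightarrow> real) \<Rightarrow> 'v set \<Rightarrow> 'v rel" where
  "dens N Z = |SOME D. spans_densely N Z D \<and> (\<forall>E. spans_densely N Z E \<longrightarrow> |D| \<le>o |E| )|"

definition linear_map_on :: "'v::real_vector set \<Rightarrow> ('v \<Rightarrow> 'x::real_vector) \<Rightarrow> bool" where
  "linear_map_on Y f \<longleftrightarrow>
     (\<forall>x\<in>Y. \<forall>y\<in>Y. f (x + y) = f x + f y) \<and> (\<forall>c. \<forall>x\<in>Y. f (c *\<^sub>R x) = c *\<^sub>R f x)"

definition isometry_on ::
    "'v::real_vector set \<Rightarrow> ('v \<Rightarrow> real) \<Rightarrow> ('v \<Rightarrow> 'x::real_normed_vector) \<Rightarrow> bool" where
  "isometry_on Y N f \<longleftrightarrow> linear_map_on Y f \<and> (\<forall>y\<in>Y. norm (f y) = N y)"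

definition UD_in ::
    "'k rel \<Rightarrow> 'v::real_vector itself \<Rightarrow> 'x::real_normed_vector itself \<Rightarrow> bool" where
  "UD_in \<kappa> V X \<longleftrightarrow>
     (\<forall>(Z :: 'v set) N Y (t :: 'v \<Rightarrow> 'x).
        normed_space_on Z N \<and> dens N Z <o \<kappa> \<and> subspace Y \<and> Y \<subseteq> Z \<and> isometry_on Y N t \<longrightarrow>
        (\<exists>T. isometry_on Z N T \<and> (\<forall>y\<in>Y. T y = t y)))"

definition AUD_in ::
    "'k rel \<Rightarrow> 'v::real_vector itself \<Rightarrow> 'x::real_normed_vector itself \<Rightarrow> bool" where
  "AUD_in \<kappa> V X \<longleftrightarrow>
     (\<forall>(Z :: 'v set) N Y (t :: 'v \<Rightarrow> 'x).
        normed_space_on Z N \<and> dens N Z <o \<kappa> \<and> subspace Y \<and> Y \<subseteq> Z \<and> isometry_on Y N t \<longrightarrow>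
        (\<forall>\<epsilon>>0. \<exists>T. linear_map_on Z T \<and> (\<forall>y\<in>Y. T y = t y) \<and>
           (\<forall>z\<in>Z. (1 - \<epsilon>) * N z \<le> norm (T z) \<and> norm (T z) \<le> (1 + \<epsilon>) * N z)))"

text \<open>
  HOL cannot quantify over all normed spaces inside a formula, so an ambient vector space that
  is large enough is fixed: the free real vector space over \<open>'k \<Rightarrow> real\<close>, where the cardinal
  \<open>\<kappa>\<close> lives on \<open>'k\<close>. Nothing is lost. A normed space of density \<open>< \<kappa>\<close> has at most as many
  elements as \<open>'k \<Rightarrow> real\<close>, so it is isomorphic to a subspace of this free space carrying the
  transported norm. The lemmas \<open>UD_imp_UD_in\<close> and \<open>AUD_imp_AUD_in\<close> below show that the
  extension property then holds for normed spaces on every type.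
\<close>

definition UD :: "'k rel \<Rightarrow> 'x::real_normed_vector itself \<Rightarrow> bool" where
  "UD \<kappa> X \<longleftrightarrow> UD_in \<kappa> TYPE(('k \<Rightarrow> real, real) poly_mapping) X"

definition AUD :: "'k rel \<Rightarrow> 'x::real_normed_vector itself \<Rightarrow> bool" where
  "AUD \<kappa> X \<longleftrightarrow> AUD_in \<kappa> TYPE(('k \<Rightarrow> real, real) poly_mapping) X"

definition ASQ :: "'k rel \<Rightarrow> 'x::real_normed_vector itself \<Rightarrow> bool" where
  "ASQ \<kappa> X \<longleftrightarrow>
     (\<forall>Y :: 'x set. subspace Y \<and> dens norm Y <o \<kappa> \<longrightarrow>
        (\<forall>\<epsilon>>0. \<exists>x\<in>sphere 0 1. \<forall>y\<in>Y. \<forall>l::real.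
           norm (y + l *\<^sub>R x) \<le> (1 + \<epsilon>) * max (norm y) \<bar>l\<bar>))"

definition SQ :: "'k rel \<Rightarrow> 'x::real_normed_vector itself \<Rightarrow> bool" where
  "SQ \<kappa> X \<longleftrightarrow>
     (\<forall>Y :: 'x set. subspace Y \<and> dens norm Y <o \<kappa> \<longrightarrow>
        (\<exists>x\<in>sphere 0 1. \<forall>y\<in>Y. \<forall>l::real. norm (y + l *\<^sub>R x) \<le> max (norm y) \<bar>l\<bar>))"

definition octahedral :: "'k rel \<Rightarrow> 'x::real_normed_vector itself \<Rightarrow> bool" where
  "octahedral \<kappa> X \<longleftrightarrow>
     (\<forall>Y :: 'x set. subspace Y \<and> dens norm Y <o \<kappa> \<longrightarrow>
        (\<forall>\<epsilon>>0. \<exists>x\<in>sphere 0 1. \<forall>y\<in>Y. \<forall>l::real.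
           norm (y + l *\<^sub>R x) \<ge> (1 - \<epsilon>) * (norm y + \<bar>l\<bar>)))"

definition fails_minus_one_BCP :: "'k rel \<Rightarrow> 'x::real_normed_vector itself \<Rightarrow> bool" where
  "fails_minus_one_BCP \<kappa> X \<longleftrightarrow>
     (\<forall>Y :: 'x set. subspace Y \<and> dens norm Y <o \<kappa> \<longrightarrow>
        (\<exists>x\<in>sphere 0 1. \<forall>y\<in>Y. \<forall>l::real. norm (y + l *\<^sub>R x) = norm y + \<bar>l\<bar>))"


lemma spans_densely_self: "normed_space_on Z N \<Longrightarrow> spans_densely N Z Z"
  unfolding spans_densely_def normed_space_on_def
  by (metis diff_self subset_refl span_base subspace_0)

lemma dens_attained:
  assumes "normed_space_on Z N"
  obtains D where "spans_densely N Z D" "dens N Z = |D|"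
    "\<And>E. spans_densely N Z E \<Longrightarrow> |D| \<le>o |E|"
proof -
  let ?R = "{ |D| | D. spans_densely N Z D}"
  have "\<exists>r\<in>?R. \<forall>r'\<in>?R. r \<le>o r'"
    by (rule exists_minim_Card_order) (use spans_densely_self[OF assms] card_of_Card_order in auto)
  then have "\<exists>D. spans_densely N Z D \<and> (\<forall>E. spans_densely N Z E \<longrightarrow> |D| \<le>o |E| )"
    by blast
  from someI_ex[OF this] show ?thesis
    using that unfolding dens_def by blast
qed

lemma dens_less_iff:
  assumes "normed_space_on Z N"
  shows "dens N Z <o \<kappa> \<longleftrightarrow> (\<exists>D. spans_densely N Z D \<and> |D| <o \<kappa>)"
proof -
  obtain D where D: "spans_densely N Z D" "dens N Z = |D|"
      "\<And>E. spans_densely N Z E \<Longrightarrow> |D| \<le>o |E|"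
    using dens_attained[OF assms] by blast
  then show ?thesis
    using ordLeq_ordLess_trans by metis
qed

lemma countable_ordLeq_infinite:
  assumes "countable C" and "infinite (UNIV :: 'k set)"
  shows "|C| \<le>o |UNIV :: 'k set|"
proof -
  have "|C| \<le>o |UNIV :: nat set|"
    using assms(1) by (meson card_of_ordLeq countable_def subset_UNIV)
  moreover have "|UNIV :: nat set| \<le>o |UNIV :: 'k set|"
    using assms(2) infinite_iff_card_of_nat by blast
  ultimately show ?thesis using ordLeq_transitive by blast
qed

lemma card_of_normed_space:
  fixes \<kappa> :: "'k rel" and Z :: "'v::real_vector set"
  assumes k: "Cinfinite \<kappa>" and Z: "normed_space_on Z N" and d: "dens N Z <o \<kappa>"
  shows "|Z| \<le>o |UNIV :: ('k \<Rightarrow> real) set|"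
proof -
  obtain D where D: "spans_densely N Z D" "|D| <o \<kappa>"
    using d dens_less_iff[OF Z] by blast
  have sZ: "subspace Z" and DZ: "D \<subseteq> Z" 
    using Z D unfolding normed_space_on_def spans_densely_def by auto
  have infF: "infinite (Field \<kappa>)" and co: "Card_order \<kappa>"
    using k by (auto simp: cinfinite_def)
  have inf: "infinite (UNIV :: 'k set)"
    using infF finite_subset[OF subset_UNIV] by blast
  have kU: "\<kappa> \<le>o |UNIV :: 'k set|"
    by (rule ordIso_ordLeq_trans[OF ordIso_symmetric[OF card_of_Field_ordIso[OF co]]
          card_of_mono1[OF subset_UNIV]])
  have DU: "|D| \<le>o |UNIV :: 'k set|"
    by (rule ordLess_imp_ordLeq[OF ordLess_ordLeq_trans[OF D(2) kU]])
  note ctU = countable_ordLeq_infinite[OF _ inf]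
  note tim = card_of_Times_ordLeq_infinite_Field[OF _ _ _ card_of_Card_order[of "UNIV :: 'k set"],
      unfolded Field_card_of, OF inf]
  define F where "F = (\<lambda>A. (\<lambda>(a, d, q). a + q *\<^sub>R d) ` (A \<times> D \<times> \<rat>))"
  define A where "A n = (F ^^ n) {0}" for n
  have A_Suc: "A (Suc n) = F (A n)" for n by (simp add: A_def)
  have cA: "|A n| \<le>o |UNIV :: 'k set|" for n
  proof (induction n)
    case 0
    show ?case using ctU[of "{0 :: 'v}"] by (simp add: A_def)
  next
    case (Suc n)
    have "|D \<times> (\<rat>::real set)| \<le>o |UNIV :: 'k set|"
      by (rule tim[OF DU ctU[OF countable_rat]])
    then have "|A n \<times> D \<times> (\<rat>::real set)| \<le>o |UNIV :: 'k set|"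
      by (rule tim[OF Suc])
    then show ?case
      unfolding A_Suc F_def by (rule ordLeq_transitive[OF card_of_image])
  qed
  define U where "U = (\<Union>n. A n)"
  have cU: "|U| \<le>o |UNIV :: 'k set|"
    unfolding U_def using cA ctU[of "UNIV :: nat set"]
    by (intro card_of_UNION_ordLeq_infinite[OF inf]) auto
  have UZ: "A n \<subseteq> Z" for n
  proof (induction n)
    case 0
    then show ?case using sZ by (simp add: A_def subspace_0)
  next
    case (Suc n)
    then show ?case
      using sZ DZ by (auto simp: A_Suc F_def subspace_add subspace_scale subset_iff)
  qed
  note Zu = Z[unfolded normed_space_on_def]
  have Nadd: "\<And>x y. x \<in> Z \<Longrightarrow> y \<in> Z \<Longrightarrow> N (x + y) \<le> N x + N y" using Zu by simp
  have Nsc: "\<And>c x. x \<in> Z \<Longrightarrow> N (c *\<^sub>R x) = \<bar>c\<bar> * N x" using Zu by simp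
  have Nnn: "\<And>x. x \<in> Z \<Longrightarrow> 0 \<le> N x" using Zu by simp
  have Nz: "\<And>x. x \<in> Z \<Longrightarrow> N x = 0 \<Longrightarrow> x = 0" using Zu by simp
  have N0: "N 0 = 0" using Zu subspace_0[OF sZ] by simp
  have Nneg: "N (- x) = N x" if "x \<in> Z" for x
    using Nsc[OF that, of "-1"] by simp
  have appr: "v \<in> Z \<and> (\<forall>e>0. \<exists>u\<in>U. N (v - u) < e)" if "v \<in> span D" for v
    using that
  proof (induction rule: span_induct_alt)
    case base
    have "0 \<in> U" unfolding U_def A_def by (rule UN_I[of 0]) auto
    then show ?case using N0 subspace_0[OF sZ] by (metis diff_self)
  next
    case (step c x y)
    have xZ: "x \<in> Z" using step DZ by auto
    have mem: "c *\<^sub>R x + y \<in> Z" using step xZ sZ by (simp add: subspace_add subspace_scale)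
    moreover have "\<exists>u\<in>U. N (c *\<^sub>R x + y - u) < e" if e: "e > 0" for e
    proof -
      obtain a n where a: "a \<in> A n" "N (y - a) < e/2"
        using step.IH e unfolding U_def by (meson UN_E half_gt_zero)
      have pos: "N x + 1 > 0" using Nnn[OF xZ] by simp
      have "c < c + e/2/(N x + 1)" using e pos by simp
      then obtain q where q: "q \<in> \<rat>" "c < q" "q < c + e/2/(N x + 1)"
        using Rats_dense_in_real by blast
      have "\<bar>c - q\<bar> < e/2/(N x + 1)" using q by simp
      then have "\<bar>c - q\<bar> * (N x + 1) < e/2" using pos_less_divide_eq[OF pos] by blast
      then have le: "\<bar>c - q\<bar> * N x < e/2"
        by (smt (verit) mult_left_mono abs_ge_zero)
      have aZ: "a \<in> Z" using UZ a by blast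
      have "a + q *\<^sub>R x \<in> A (Suc n)"
        unfolding A_Suc F_def using a q step by (intro image_eqI[of _ _ "(a, x, q)"]) auto
      then have "a + q *\<^sub>R x \<in> U" unfolding U_def by blast
      moreover have "N (c *\<^sub>R x + y - (a + q *\<^sub>R x)) < e"
      proof -
        have eq: "c *\<^sub>R x + y - (a + q *\<^sub>R x) = (c - q) *\<^sub>R x + (y - a)"
          by (simp add: algebra_simps)
        have "y - a \<in> Z" using step.IH aZ subspace_diff[OF sZ] by blast
        then have "N ((c - q) *\<^sub>R x + (y - a)) \<le> N ((c - q) *\<^sub>R x) + N (y - a)"
          by (rule Nadd[OF subspace_scale[OF sZ xZ]])
        then show ?thesis unfolding eq Nsc[OF xZ] using le a(2) by linarith
      qed
      ultimately show ?thesis by blast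
    qed
    ultimately show ?case by blast
  qed
  have dU: "\<exists>u\<in>U. N (v - u) < e" if v: "v \<in> Z" and e: "e > 0" for v e
  proof -
    obtain w where w: "w \<in> span D" "N (v - w) < e/2"
      using D(1) v e unfolding spans_densely_def by (meson half_gt_zero)
    obtain u where u: "u \<in> U" "N (w - u) < e/2"
      using appr[OF w(1)] e by (meson half_gt_zero)
    have "w \<in> Z" using appr[OF w(1)] by blast
    moreover have "u \<in> Z" using u UZ unfolding U_def by blast
    ultimately have "N ((v - w) + (w - u)) \<le> N (v - w) + N (w - u)"
      using Nadd subspace_diff[OF sZ] v by blast
    then show ?thesis using u w by (intro bexI[of _ u]) auto
  qed
  obtain h :: "_ \<Rightarrow> 'k" where h: "inj_on h U"
    using cU unfolding card_of_ordLeq[symmetric] by blast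
  define G where "G v = (\<lambda>k. if k \<in> h ` U then N (v - inv_into U h k) else 0)" for v
  have "inj_on G Z"
  proof (rule inj_onI)
    fix v w assume vw: "v \<in> Z" "w \<in> Z" "G v = G w"
    have eq: "N (v - u) = N (w - u)" if "u \<in> U" for u
      using fun_cong[OF vw(3), of "h u"] that h by (simp add: G_def)
    have "N (v - w) \<le> e" if e: "e > 0" for e
    proof -
      obtain u where u: "u \<in> U" "N (v - u) < e/2" using dU[OF vw(1), of "e/2"] e by auto
      have uZ: "u \<in> Z" using u UZ unfolding U_def by blast
      have "N ((v - u) + - (w - u)) \<le> N (v - u) + N (- (w - u))"
        using Nadd subspace_diff[OF sZ] subspace_neg[OF sZ] vw uZ by blast
      then show ?thesis
        using Nneg[of "w - u"] subspace_diff[OF sZ vw(2) uZ] eq[OF u(1)] u(2) by simp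
    qed
    then have "N (v - w) \<le> 0" by (rule field_le_epsilon[of _ 0, simplified])
    then show "v = w"
      using Nz[of "v - w"] Nnn[of "v - w"] subspace_diff[OF sZ vw(1,2)] by simp
  qed
  then show ?thesis unfolding card_of_ordLeq[symmetric] by blast
qed

lemma independent_single:
  "independent ((\<lambda>i. Poly_Mapping.single i (1::real)) ` I)"
proof -
  have lk: "Poly_Mapping.lookup (c *\<^sub>R x) i = c * Poly_Mapping.lookup x i"
    for c i and x :: "('a, real) poly_mapping"
  proof -
    have "finite {i. c *\<^sub>R Poly_Mapping.lookup x i \<noteq> 0}"
      by (rule finite_subset[OF _ finite_lookup[of x]]) auto
    then show ?thesis by (simp add: scaleR_poly_mapping_def)
  qed
  have z: "Poly_Mapping.lookup x i = 0"
    if "x \<in> span ((\<lambda>i. Poly_Mapping.single i (1::real)) ` I - {Poly_Mapping.single i 1})" for x i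
    using that
    by (induction rule: span_induct_alt) (auto simp: lookup_add lk lookup_single when_def split: if_splits)
  show ?thesis
    unfolding dependent_def using z by (force simp: lookup_single)
qed

lemma embed_free_space:
  fixes \<kappa> :: "'k rel" and Z :: "'v::real_vector set"
  assumes "Cinfinite \<kappa>" and Z: "normed_space_on Z N" and "dens N Z <o \<kappa>"
  obtains f :: "'v \<Rightarrow> ('k \<Rightarrow> real, real) poly_mapping" where "linear f" "inj_on f Z"
proof -
  have sZ: "subspace Z" using Z by (simp add: normed_space_on_def)
  obtain B where B: "B \<subseteq> Z" "independent B" "Z \<subseteq> span B"
    using maximal_independent_subset by blast
  obtain j :: "'v \<Rightarrow> 'k \<Rightarrow> real" where j: "inj_on j Z"
    using card_of_normed_space[OF assms] unfolding card_of_ordLeq[symmetric] by blast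
  define s where "s i = Poly_Mapping.single i (1::real)" for i :: "'k \<Rightarrow> real"
  have injs: "inj s"
    by (rule injI) (metis s_def lookup_single_eq lookup_single_not_eq zero_neq_one)
  obtain f where f: "linear f" "\<And>b. b \<in> B \<Longrightarrow> f b = s (j b)"
    using linear_independent_extend[OF B(2), of "\<lambda>b. s (j b)"] by blast
  have img: "f ` B = s ` (j ` B)" using f(2) by force
  have "independent (f ` B)" unfolding img s_def by (rule independent_single)
  moreover have "inj_on f B"
    using f(2) injs j B(1) by (metis (no_types, lifting) inj_on_def injD subset_iff)
  ultimately have "inj_on f (span B)"
    using linear_inj_on_span_independent_image[OF f(1)] by blast
  then show ?thesis using that f(1) B(3) inj_on_subset by blast
qed

lemma transport_normed_space:
  fixes Z :: "'v::real_vector set" and f :: "'v \<Rightarrow> 'w::real_vector"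
  assumes f: "linear f" "inj_on f Z" and Z: "normed_space_on Z N" and d: "dens N Z <o \<kappa>"
    and Y: "subspace Y" "Y \<subseteq> Z" and t: "isometry_on Y N t"
  defines "g \<equiv> inv_into Z f"
  shows "normed_space_on (f ` Z) (N \<circ> g)" "dens (N \<circ> g) (f ` Z) <o \<kappa>"
    "subspace (f ` Y)" "f ` Y \<subseteq> f ` Z" "isometry_on (f ` Y) (N \<circ> g) (t \<circ> g)"
proof -
  have sZ: "subspace Z" using Z by (simp add: normed_space_on_def)
  have g: "g (f z) = z" if "z \<in> Z" for z using that f by (simp add: g_def)
  have f0: "f z = 0 \<longleftrightarrow> z = 0" if "z \<in> Z" for z
    using g[OF that] g[OF subspace_0[OF sZ]] linear_0[OF f(1)] by auto
  note lin = linear_add[OF f(1), symmetric] linear_scale[OF f(1), symmetric]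
    linear_diff[OF f(1), symmetric]
  note mem = subspace_add[OF sZ] subspace_scale[OF sZ] subspace_diff[OF sZ]
  show nZ: "normed_space_on (f ` Z) (N \<circ> g)"
    using Z linear_subspace_image[OF f(1) sZ]
    by (auto simp: normed_space_on_def lin mem g f0)
  obtain D where D: "spans_densely N Z D" "|D| <o \<kappa>"
    using d dens_less_iff[OF Z] by blast
  have sp: "span D \<subseteq> Z" using D sZ by (simp add: spans_densely_def span_minimal)
  have "spans_densely (N \<circ> g) (f ` Z) (f ` D)"
    unfolding spans_densely_def
  proof (intro conjI ballI allI impI)
    show "f ` D \<subseteq> f ` Z" using D by (auto simp: spans_densely_def)
    fix z e :: _ assume "z \<in> f ` Z" and e: "(e::real) > 0"
    then obtain v where v: "v \<in> Z" "z = f v" by blast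
    obtain u where u: "u \<in> span D" "N (v - u) < e"
      using D v e unfolding spans_densely_def by blast
    have "(N \<circ> g) (z - f u) < e" using u v sp by (auto simp: lin mem g subset_iff)
    moreover have "f u \<in> span (f ` D)"
      using u linear_span_image[OF f(1)] by auto
    ultimately show "\<exists>u\<in>span (f ` D). (N \<circ> g) (z - u) < e" by blast
  qed
  moreover have "|f ` D| <o \<kappa>" using D(2) card_of_image ordLeq_ordLess_trans by blast
  ultimately show "dens (N \<circ> g) (f ` Z) <o \<kappa>"
    using dens_less_iff[OF nZ] by blast
  show "subspace (f ` Y)" using linear_subspace_image[OF f(1) Y(1)] .
  show "f ` Y \<subseteq> f ` Z" using Y by blast
  have gY: "g (f y) = y" if "y \<in> Y" for y using that Y g by auto
  show "isometry_on (f ` Y) (N \<circ> g) (t \<circ> g)"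
    using t by (auto simp: isometry_on_def linear_map_on_def lin gY
        subspace_add[OF Y(1)] subspace_scale[OF Y(1)])
qed

lemma UD_imp_UD_in:
  fixes \<kappa> :: "'k rel"
  assumes k: "Cinfinite \<kappa>" and U: "UD \<kappa> TYPE('x::real_normed_vector)"
  shows "UD_in \<kappa> TYPE('v::real_vector) TYPE('x)"
  unfolding UD_in_def
proof (intro allI impI, elim conjE)
  fix Z :: "'v set" and N Y and t :: "'v \<Rightarrow> 'x"
  assume a: "normed_space_on Z N" "dens N Z <o \<kappa>" "subspace Y" "Y \<subseteq> Z" "isometry_on Y N t"
  obtain f :: "'v \<Rightarrow> ('k \<Rightarrow> real, real) poly_mapping" where f: "linear f" "inj_on f Z"
    using embed_free_space[OF k a(1,2)] by blast
  have sZ: "subspace Z" using a by (simp add: normed_space_on_def)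
  obtain T :: "_ \<Rightarrow> 'x" where T: "isometry_on (f ` Z) (N \<circ> inv_into Z f) T"
      "\<forall>y\<in>f ` Y. T y = (t \<circ> inv_into Z f) y"
    using U transport_normed_space[OF f a] unfolding UD_def UD_in_def by blast
  have "isometry_on Z N (T \<circ> f)"
    using T(1) f by (auto simp: isometry_on_def linear_map_on_def linear_add linear_scale)
  moreover have "\<forall>y\<in>Y. (T \<circ> f) y = t y"
    using T(2) f(2) a(4) by (auto simp: subset_iff)
  ultimately show "\<exists>T. isometry_on Z N T \<and> (\<forall>y\<in>Y. T y = t y)" by blast
qed

lemma AUD_imp_AUD_in:
  fixes \<kappa> :: "'k rel"
  assumes k: "Cinfinite \<kappa>" and U: "AUD \<kappa> TYPE('x::real_normed_vector)"
  shows "AUD_in \<kappa> TYPE('v::real_vector) TYPE('x)"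
  unfolding AUD_in_def
proof (intro allI impI, elim conjE)
  fix Z :: "'v set" and N Y and t :: "'v \<Rightarrow> 'x" and \<epsilon> :: real
  assume a: "normed_space_on Z N" "dens N Z <o \<kappa>" "subspace Y" "Y \<subseteq> Z" "isometry_on Y N t"
    and e: "\<epsilon> > 0"
  obtain f :: "'v \<Rightarrow> ('k \<Rightarrow> real, real) poly_mapping" where f: "linear f" "inj_on f Z"
    using embed_free_space[OF k a(1,2)] by blast
  obtain T :: "_ \<Rightarrow> 'x" where T: "linear_map_on (f ` Z) T"
      "\<forall>y\<in>f ` Y. T y = (t \<circ> inv_into Z f) y"
      "\<forall>z\<in>f ` Z. (1 - \<epsilon>) * (N \<circ> inv_into Z f) z \<le> norm (T z) \<and>
         norm (T z) \<le> (1 + \<epsilon>) * (N \<circ> inv_into Z f) z"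
    using U[unfolded AUD_def AUD_in_def, rule_format, OF _ e,
        of "f ` Z" "N \<circ> inv_into Z f" "f ` Y" "t \<circ> inv_into Z f"]
      transport_normed_space[OF f a] by blast
  have "linear_map_on Z (T \<circ> f)"
    using T(1) f by (auto simp: linear_map_on_def linear_add linear_scale)
  moreover have "\<forall>y\<in>Y. (T \<circ> f) y = t y"
    using T(2) f(2) a(4) by (auto simp: subset_iff)
  moreover have "\<forall>z\<in>Z. (1 - \<epsilon>) * N z \<le> norm ((T \<circ> f) z) \<and> norm ((T \<circ> f) z) \<le> (1 + \<epsilon>) * N z"
    using T(3) f(2) by auto
  ultimately show "\<exists>T. linear_map_on Z T \<and> (\<forall>y\<in>Y. T y = t y) \<and>
      (\<forall>z\<in>Z. (1 - \<epsilon>) * N z \<le> norm (T z) \<and> norm (T z) \<le> (1 + \<epsilon>) * N z)" by blast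
qed

end

theory Submission
  imports Defs
begin

text \<open>
  Given a subspace \<open>Y\<close> of \<open>X\<close> of density \<open>< \<kappa>\<close>, adjoin one new direction: equip \<open>Y \<times> \<real>\<close> with
  the norm \<open>max \<parallel>y\<parallel> \<bar>l\<bar>\<close> or \<open>\<parallel>y\<parallel> + \<bar>l\<bar>\<close>. Since \<open>\<kappa>\<close> is infinite, adjoining one dimension keeps
  the density below \<open>\<kappa>\<close>, so the embedding \<open>(y, 0) \<mapsto> y\<close> of \<open>Y \<times> {0}\<close> into \<open>X\<close> extends to some
  \<open>T\<close> on \<open>Y \<times> \<real>\<close>. With \<open>x = T (0, 1)\<close> linearity gives \<open>T (y, l) = y + l x\<close>, so
  the norm of \<open>y + l x\<close> is controlled by the chosen norm of \<open>(y, l)\<close>. The max-norm yields the square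
  properties, the sum-norm the octahedral ones.

  In the almost isometric case \<open>x\<close> has norm only close to 1. Normalizing it moves \<open>y + l x\<close> by
  at most a small multiple of \<open>\<bar>l\<bar>\<close>, and \<open>\<bar>l\<bar>\<close> is dominated by either norm of \<open>(y, l)\<close>.
  The two norms share everything that the argument uses; this common part is
  \<open>one_dim_extension_norm\<close>, and the vector \<open>x\<close> is produced from it in \<open>UD_unit_vector\<close>
  and \<open>AUD_unit_vector\<close>.
\<close>

definition one_dim_extension_norm :: "'x::real_normed_vector set \<Rightarrow> ('x \<times> real \<Rightarrow> real) \<Rightarrow> bool" where
  "one_dim_extension_norm Y N \<longleftrightarrow> normed_space_on (Y \<times> UNIV) N \<and>
     (\<forall>y\<in>Y. N (y, 0) = norm y) \<and> N (0, 1) = 1 \<and> (\<forall>y\<in>Y. \<forall>l. \<bar>l\<bar> \<le> N (y, l))"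

lemma one_dim_extension_norm_max:
  assumes "subspace Y"
  shows "one_dim_extension_norm Y (\<lambda>(y, l). max (norm y) \<bar>l\<bar>)"
proof -
  have "max (norm (x + y)) \<bar>l + m\<bar> \<le> max (norm x) \<bar>l\<bar> + max (norm y) \<bar>m\<bar>" for x y :: 'a and l m :: real
    using norm_triangle_ineq[of x y] by linarith
  moreover have "max (norm x) \<bar>l\<bar> = 0 \<longleftrightarrow> x = 0 \<and> l = 0" for x :: 'a and l :: real
    by (auto simp: max_def)
  moreover have "max (\<bar>c\<bar> * a) (\<bar>c\<bar> * b) = \<bar>c\<bar> * max a b" for a b c :: real
    by (simp add: max_mult_distrib_left)
  ultimately show ?thesis
    using assms
    by (auto simp: one_dim_extension_norm_def normed_space_on_def subspace_Times zero_prod_def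
        abs_mult le_max_iff_disj)
qed

lemma one_dim_extension_norm_sum:
  assumes "subspace Y"
  shows "one_dim_extension_norm Y (\<lambda>(y, l). norm y + \<bar>l\<bar>)"
proof -
  have "norm (x + y) + \<bar>l + m\<bar> \<le> norm x + \<bar>l\<bar> + (norm y + \<bar>m\<bar>)" for x y :: 'a and l m :: real
    using norm_triangle_ineq[of x y] by linarith
  moreover have "norm x + \<bar>l\<bar> = 0 \<longleftrightarrow> x = 0 \<and> l = 0" for x :: 'a and l :: real
    by (simp add: add_nonneg_eq_0_iff)
  ultimately show ?thesis
    using assms
    by (auto simp: one_dim_extension_norm_def normed_space_on_def subspace_Times zero_prod_def
        abs_mult distrib_left)
qed

lemma subspace_normed_space_on: "subspace Y \<Longrightarrow> normed_space_on Y norm"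
  by (simp add: normed_space_on_def norm_triangle_ineq)

text \<open>
  A densely spanning set of \<open>Y\<close> together with the vector \<open>(0, 1)\<close> spans the extension densely.
  That \<open>\<kappa>\<close> is infinite is what lets it absorb the additional vector.
\<close>
lemma dens_one_dim_extension:
  fixes Y :: "'x::real_normed_vector set"
  assumes k: "Cinfinite \<kappa>" and Y: "subspace Y" "dens norm Y <o \<kappa>"
    and N: "one_dim_extension_norm Y N"
  shows "dens N (Y \<times> UNIV) <o \<kappa>"
proof -
  obtain D where D: "spans_densely norm Y D" "|D| <o \<kappa>"
    using Y(2) dens_less_iff[OF subspace_normed_space_on[OF Y(1)]] by blast
  define E where "E = (\<lambda>d. (d, 0::real)) ` D \<union> {(0, 1)}"
  have nZ: "normed_space_on (Y \<times> UNIV) N" and N0: "\<And>y. y \<in> Y \<Longrightarrow> N (y, 0) = norm y"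
    using N by (auto simp: one_dim_extension_norm_def)
  have DY: "D \<subseteq> Y" using D by (simp add: spans_densely_def)
  have inf: "infinite (Field \<kappa>)" and co: "Card_order \<kappa>"
    using k by (auto simp: cinfinite_def)
  have "|(\<lambda>d. (d, 0::real)) ` D| <o \<kappa>"
    using D(2) card_of_image ordLeq_ordLess_trans by blast
  moreover have "|{(0::'x, 1::real)}| <o \<kappa>"
    by (rule finite_ordLess_infinite[OF card_of_Well_order _ _ inf])
      (use co in \<open>simp_all add: Field_card_of card_order_on_well_order_on\<close>)
  ultimately have E: "|E| <o \<kappa>"
    unfolding E_def using card_of_Un_ordLess_infinite_Field[OF inf co] by blast
  have lin: "linear (\<lambda>d. (d :: 'x, 0::real))" by (rule linearI) auto
  have "spans_densely N (Y \<times> UNIV) E"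
    unfolding spans_densely_def
  proof (intro conjI ballI allI impI)
    show "E \<subseteq> Y \<times> UNIV" using DY subspace_0[OF Y(1)] by (auto simp: E_def)
    fix z and e :: real assume "z \<in> Y \<times> (UNIV :: real set)" and e: "e > 0"
    then obtain y l where z: "z = (y, l)" "y \<in> Y" by blast
    obtain u where u: "u \<in> span D" "norm (y - u) < e"
      using D(1) z(2) e unfolding spans_densely_def by blast
    have "u \<in> Y" using u(1) DY Y(1) span_minimal by blast
    then have "N (z - (u, l)) = norm (y - u)"
      using N0 subspace_diff[OF Y(1) z(2)] by (simp add: z(1))
    moreover have "(u, 0) \<in> span E"
      using u(1) linear_span_image[OF lin, of D] span_mono[of "(\<lambda>d. (d, 0)) ` D" E]
      by (auto simp: E_def)
    then have "(u, 0) + l *\<^sub>R (0, 1) \<in> span E"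
      by (intro span_add span_scale) (auto simp: E_def intro: span_base)
    ultimately show "\<exists>u\<in>span E. N (z - u) < e"
      using u(2) by (intro bexI[of _ "(u, l)"]) auto
  qed
  with E show ?thesis using dens_less_iff[OF nZ] by blast
qed

lemma isometry_on_fst:
  assumes "one_dim_extension_norm Y N"
  shows "isometry_on (Y \<times> {0}) N fst"
  using assms by (auto simp: one_dim_extension_norm_def isometry_on_def linear_map_on_def)

lemma linear_extension_of_fst:
  assumes Y: "subspace Y" and T: "linear_map_on (Y \<times> (UNIV :: real set)) T"
    and ext: "\<forall>z\<in>Y \<times> {0}. T z = fst z" and y: "y \<in> Y"
  shows "T (y, l) = y + l *\<^sub>R T (0, 1)"
proof -
  have "T ((y, 0) + l *\<^sub>R (0, 1)) = T (y, 0) + l *\<^sub>R T (0, 1)"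
    using T y subspace_0[OF Y] unfolding linear_map_on_def
    by (metis (no_types, lifting) SigmaI UNIV_I scaleR_Pair scaleR_zero_right)
  then show ?thesis using ext y by simp
qed

text \<open>
  The unit vector is the image of \<open>(0, 1)\<close> under an isometric extension of the inclusion
  \<open>Y \<rightarrow> X\<close>.
\<close>
lemma UD_unit_vector:
  fixes \<kappa> :: "'k rel" and Y :: "'x::real_normed_vector set"
  assumes k: "Cinfinite \<kappa>" and U: "UD \<kappa> TYPE('x)"
    and Y: "subspace Y" "dens norm Y <o \<kappa>" and N: "one_dim_extension_norm Y N"
  shows "\<exists>x\<in>sphere 0 1. \<forall>y\<in>Y. \<forall>l. norm (y + l *\<^sub>R x) = N (y, l)"
proof -
  have "subspace (Y \<times> {0::real})" "Y \<times> {0::real} \<subseteq> Y \<times> UNIV"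
    using Y(1) by (auto simp: subspace_Times)
  then obtain T :: "'x \<times> real \<Rightarrow> 'x" where T: "isometry_on (Y \<times> UNIV) N T"
      and ext: "\<forall>z\<in>Y \<times> {0}. T z = fst z"
    using UD_imp_UD_in[OF k U, where 'v = "'x \<times> real", unfolded UD_in_def]
      dens_one_dim_extension[OF k Y N] isometry_on_fst[OF N] N
    unfolding one_dim_extension_norm_def by blast
  have "norm (y + l *\<^sub>R T (0, 1)) = N (y, l)" if "y \<in> Y" for y l
    using T linear_extension_of_fst[OF Y(1) _ ext that, of l] that
    unfolding isometry_on_def by (metis SigmaI UNIV_I)
  moreover from this[of 0 1] have "T (0, 1) \<in> sphere 0 1"
    using N subspace_0[OF Y(1)] by (simp add: one_dim_extension_norm_def)
  ultimately show ?thesis by blast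
qed

text \<open>
  The image \<open>w\<close> of \<open>(0, 1)\<close> has norm within \<open>\<delta>\<close> of 1, so replacing \<open>w\<close> by \<open>w / \<parallel>w\<parallel>\<close> changes
  \<open>\<parallel>y + l w\<parallel>\<close> by at most \<open>\<delta> \<bar>l\<bar> \<le> \<delta> N (y, l)\<close>, an error of the same kind as the distortion of
  the extension itself.
\<close>
lemma AUD_unit_vector:
  fixes \<kappa> :: "'k rel" and Y :: "'x::real_normed_vector set" and \<epsilon> :: real
  assumes k: "Cinfinite \<kappa>" and A: "AUD \<kappa> TYPE('x)"
    and Y: "subspace Y" "dens norm Y <o \<kappa>" and N: "one_dim_extension_norm Y N" and e: "\<epsilon> > 0"
  shows "\<exists>x\<in>sphere 0 1. \<forall>y\<in>Y. \<forall>l.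
    (1 - \<epsilon>) * N (y, l) \<le> norm (y + l *\<^sub>R x) \<and> norm (y + l *\<^sub>R x) \<le> (1 + \<epsilon>) * N (y, l)"
proof -
  \<comment> \<open>One half of \<open>\<epsilon>\<close> is spent on the extension and the other on normalizing \<open>T (0, 1)\<close>;
      the bound \<open>\<delta> < 1\<close> ensures that this vector is nonzero.\<close>
  define \<delta> where "\<delta> = min \<epsilon> 1 / 2"
  have \<delta>: "\<delta> > 0" "\<delta> < 1" "2 * \<delta> \<le> \<epsilon>" using e by (auto simp: \<delta>_def)
  have "subspace (Y \<times> {0::real})" "Y \<times> {0::real} \<subseteq> Y \<times> UNIV"
    using Y(1) by (auto simp: subspace_Times)
  then obtain T :: "'x \<times> real \<Rightarrow> 'x" where T: "linear_map_on (Y \<times> UNIV) T"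
      and ext: "\<forall>z\<in>Y \<times> {0}. T z = fst z"
      and bd: "\<forall>z\<in>Y \<times> UNIV. (1 - \<delta>) * N z \<le> norm (T z) \<and> norm (T z) \<le> (1 + \<delta>) * N z"
    using AUD_imp_AUD_in[OF k A, where 'v = "'x \<times> real", unfolded AUD_in_def, rule_format,
        of "Y \<times> UNIV" N "Y \<times> {0}" fst \<delta>]
      dens_one_dim_extension[OF k Y N] isometry_on_fst[OF N] N \<delta>(1)
    unfolding one_dim_extension_norm_def by blast
  define w where "w = T (0, 1)"
  define x where "x = w /\<^sub>R norm w"
  have w: "1 - \<delta> \<le> norm w" "norm w \<le> 1 + \<delta>"
    using bd[rule_format, of "(0, 1)"] N subspace_0[OF Y(1)]
    by (auto simp: w_def one_dim_extension_norm_def)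
  then have w0: "w \<noteq> 0" using \<delta>(2) by auto
  have "x - w = (1 - norm w) *\<^sub>R x" using w0 by (simp add: x_def algebra_simps)
  moreover have x1: "norm x = 1" using w0 by (simp add: x_def)
  ultimately have xw: "norm (x - w) \<le> \<delta>" using w by simp
  have "(1 - \<epsilon>) * N (y, l) \<le> norm (y + l *\<^sub>R x) \<and> norm (y + l *\<^sub>R x) \<le> (1 + \<epsilon>) * N (y, l)"
    if y: "y \<in> Y" for y l
  proof -
    have lN: "\<bar>l\<bar> \<le> N (y, l)" using N y by (simp add: one_dim_extension_norm_def)
    have "T (y, l) = y + l *\<^sub>R w"
      using linear_extension_of_fst[OF Y(1) T ext y] by (simp add: w_def)
    then have old: "(1 - \<delta>) * N (y, l) \<le> norm (y + l *\<^sub>R w)"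
        "norm (y + l *\<^sub>R w) \<le> (1 + \<delta>) * N (y, l)"
      using bd y by (metis SigmaI UNIV_I)+
    have eq: "(y + l *\<^sub>R x) - (y + l *\<^sub>R w) = l *\<^sub>R (x - w)" by (simp add: algebra_simps)
    have "norm (l *\<^sub>R (x - w)) \<le> N (y, l) * \<delta>"
      unfolding norm_scaleR using lN xw by (intro mult_mono) auto
    then have "\<bar>norm (y + l *\<^sub>R x) - norm (y + l *\<^sub>R w)\<bar> \<le> N (y, l) * \<delta>"
      using norm_triangle_ineq3[of "y + l *\<^sub>R x" "y + l *\<^sub>R w"] unfolding eq by linarith
    moreover have "(2 * \<delta>) * N (y, l) \<le> \<epsilon> * N (y, l)"
      using \<delta>(3) lN by (intro mult_right_mono) auto
    ultimately show ?thesis using old by (simp add: algebra_simps) linarith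
  qed
  then show ?thesis using x1 by (intro bexI[of _ x]) auto
qed

theorem corollary4p18:
  fixes \<kappa> :: "'k rel"
  assumes "Card_order \<kappa>" and "infinite (Field \<kappa>)"
  shows "(AUD \<kappa> TYPE('x::banach) \<longrightarrow> ASQ \<kappa> TYPE('x) \<and> octahedral \<kappa> TYPE('x)) \<and>
         (UD \<kappa> TYPE('x) \<longrightarrow> SQ \<kappa> TYPE('x) \<and> fails_minus_one_BCP \<kappa> TYPE('x))"
proof -
  have k: "Cinfinite \<kappa>" using assms by (simp add: cinfinite_def)
  note M = one_dim_extension_norm_max and S = one_dim_extension_norm_sum
  have "ASQ \<kappa> TYPE('x)" if A: "AUD \<kappa> TYPE('x)"
    unfolding ASQ_def
  proof (intro allI impI, elim conjE)
    fix Y :: "'x set" and \<epsilon> :: real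
    assume "subspace Y" "dens norm Y <o \<kappa>" "\<epsilon> > 0"
    from AUD_unit_vector[OF k A this(1,2) M[OF this(1)] this(3)]
    show "\<exists>x\<in>sphere 0 1. \<forall>y\<in>Y. \<forall>l. norm (y + l *\<^sub>R x) \<le> (1 + \<epsilon>) * max (norm y) \<bar>l\<bar>"
      unfolding prod.case by blast
  qed
  moreover have "octahedral \<kappa> TYPE('x)" if A: "AUD \<kappa> TYPE('x)"
    unfolding octahedral_def
  proof (intro allI impI, elim conjE)
    fix Y :: "'x set" and \<epsilon> :: real
    assume "subspace Y" "dens norm Y <o \<kappa>" "\<epsilon> > 0"
    from AUD_unit_vector[OF k A this(1,2) S[OF this(1)] this(3)]
    show "\<exists>x\<in>sphere 0 1. \<forall>y\<in>Y. \<forall>l. norm (y + l *\<^sub>R x) \<ge> (1 - \<epsilon>) * (norm y + \<bar>l\<bar>)"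
      unfolding prod.case by blast
  qed
  moreover have "SQ \<kappa> TYPE('x)" if U: "UD \<kappa> TYPE('x)"
    unfolding SQ_def
  proof (intro allI impI, elim conjE)
    fix Y :: "'x set"
    assume "subspace Y" "dens norm Y <o \<kappa>"
    from UD_unit_vector[OF k U this M[OF this(1)]]
    show "\<exists>x\<in>sphere 0 1. \<forall>y\<in>Y. \<forall>l. norm (y + l *\<^sub>R x) \<le> max (norm y) \<bar>l\<bar>"
      unfolding prod.case by (metis order_refl)
  qed
  moreover have "fails_minus_one_BCP \<kappa> TYPE('x)" if U: "UD \<kappa> TYPE('x)"
    unfolding fails_minus_one_BCP_def
  proof (intro allI impI, elim conjE)
    fix Y :: "'x set"
    assume "subspace Y" "dens norm Y <o \<kappa>"
    from UD_unit_vector[OF k U this S[OF this(1)]]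
    show "\<exists>x\<in>sphere 0 1. \<forall>y\<in>Y. \<forall>l. norm (y + l *\<^sub>R x) = norm y + \<bar>l\<bar>"
      unfolding prod.case .
  qed
  ultimately show ?thesis by blast
qed

end
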